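(* Let $Y=g(X,\varepsilon)$, where $\varepsilon$ has CDF $F_\varepsilon$, let $V$ be a control variable, and let $\mu(X)=\int g(X,\varepsilon)\,dF_\varepsilon(\varepsilon)$ be the average structural function (ASF). (i) Suppose $E[Y\mid X,V]=p(X)'q_0(V)$ for a known $J$-vector of functions $p(X)$ and an unknown $J$-vector of functional coefficients $q_0(V)$, and that $\mu(X)=p(X)'E[q_0(V)]$. If $E[\{p(X)'q_0(V)\}^2]<\infty$ and $E[p(X)p(X)'\mid V]$ is nonsingular with probability one, then the ASF is identified. (ii) Suppose $E[Y\mid X,V]=p_0(X)'q(V)$ for a known $K$-vector of functions $q(V)$ and an unknown $K$-vector of functional coefficients $p_0(X)$, and that $\mu(X)=p_0(X)'E[q(V)]$. If $E[\{p_0(X)'q(V)\}^2]<\infty$ and $E[q(V)q(V)'\mid X]$ is nonsingular with probability one, then the ASF is identified.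
   Context: $J,K$ are finite; all expectations written are assumed to exist. The joint distribution of $(Y,X,V)$ is regarded as known. ASF identification in case (i) means: there is no measurable $\bar q$ (with $E[\bar q(V)]$ finite) that is observationally equivalent to $q_0$, i.e. $p(X)'\bar q(V)=p(X)'q_0(V)$ almost surely, and for which $p(X)'E[\bar q(V)]\neq p(X)'E[q_0(V)]$ with positive probability. In case (ii) it means: there is no measurable $\bar p$ with $\bar p(X)'q(V)=p_0(X)'q(V)$ almost surely and $\bar p(X)'E[q(V)]\neq p_0(X)'E[q(V)]$ with positive probability. *)

theory Defs
  imports "HOL-Probability.Probability"
begin

definition sigma_gen :: "'w measure \<Rightarrow> 'a measure \<Rightarrow> ('w \<Rightarrow> 'a) \<Rightarrow> 'w measure" where
  "sigma_gen M S Z = vimage_algebra (space M) Z S"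

definition cond_exp_given ::
    "'w measure \<Rightarrow> 'a measure \<Rightarrow> ('w \<Rightarrow> 'a) \<Rightarrow> ('w \<Rightarrow> real) \<Rightarrow> 'w \<Rightarrow> real" where
  "cond_exp_given M S Z Y = real_cond_exp M (sigma_gen M S Z) Y"

definition cond_second_moment ::
    "'w measure \<Rightarrow> 'a measure \<Rightarrow> ('w \<Rightarrow> 'a) \<Rightarrow> ('w \<Rightarrow> real ^ 'n) \<Rightarrow> 'w \<Rightarrow> real ^ 'n ^ 'n" where
  "cond_second_moment M S Z W \<omega> =
     (\<chi> i j. cond_exp_given M S Z (\<lambda>\<omega>'. W \<omega>' $ i * W \<omega>' $ j) \<omega>)"

(* V is a control variable when X and eps are independent conditional on V, in the sense
   P(X : A, eps : B | V) = P(X : A | V) P(eps : B | V) almost surely for all measurable A, B. *)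
definition control_variable ::
    "'w measure \<Rightarrow> 'x measure \<Rightarrow> ('w \<Rightarrow> 'x) \<Rightarrow> 'e measure \<Rightarrow> ('w \<Rightarrow> 'e) \<Rightarrow>
     'v measure \<Rightarrow> ('w \<Rightarrow> 'v) \<Rightarrow> bool" where
  "control_variable M SX X SE eps SV V \<longleftrightarrow>
     V \<in> measurable M SV \<and>
     (\<forall>A\<in>sets SX. \<forall>B\<in>sets SE. AE \<omega> in M.
        cond_exp_given M SV V (\<lambda>\<omega>'. indicator A (X \<omega>') * indicator B (eps \<omega>')) \<omega>
        = cond_exp_given M SV V (\<lambda>\<omega>'. indicator A (X \<omega>')) \<omega>
          * cond_exp_given M SV V (\<lambda>\<omega>'. indicator B (eps \<omega>')) \<omega>)"

(* Integration against the CDF of eps is integration against its law. *)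
definition ASF ::
    "'w measure \<Rightarrow> 'e measure \<Rightarrow> ('w \<Rightarrow> 'e) \<Rightarrow> ('x \<Rightarrow> 'e \<Rightarrow> real) \<Rightarrow> 'x \<Rightarrow> real" where
  "ASF M SE eps g x = (\<integral>e. g x e \<partial>(distr M SE eps))"

(* Identification is relative to the law of (Y, X, V), which enters through M: no admissible
   coefficient that is observationally equivalent to the true one yields a different ASF.
   The ASF is written through its representation p(X)' E[q0(V)]. *)
definition ASF_identified_known_p ::
    "'w measure \<Rightarrow> ('w \<Rightarrow> 'x) \<Rightarrow> 'v measure \<Rightarrow> ('w \<Rightarrow> 'v) \<Rightarrow>
     ('x \<Rightarrow> real ^ 'j) \<Rightarrow> ('v \<Rightarrow> real ^ 'j) \<Rightarrow> bool" where
  "ASF_identified_known_p M X SV V p q0 \<longleftrightarrow>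
     \<not> (\<exists>qb. qb \<in> borel_measurable SV \<and>
           integrable M (\<lambda>\<omega>. qb (V \<omega>)) \<and>
           (AE \<omega> in M. p (X \<omega>) \<bullet> qb (V \<omega>) = p (X \<omega>) \<bullet> q0 (V \<omega>)) \<and>
           measure M {\<omega> \<in> space M. p (X \<omega>) \<bullet> (\<integral>\<omega>'. qb (V \<omega>') \<partial>M)
                                  \<noteq> p (X \<omega>) \<bullet> (\<integral>\<omega>'. q0 (V \<omega>') \<partial>M)} > 0)"

(* Here the alternatives pb carry no integrability requirement: only E[q(V)] enters the ASF. *)
definition ASF_identified_known_q ::
    "'w measure \<Rightarrow> 'x measure \<Rightarrow> ('w \<Rightarrow> 'x) \<Rightarrow> ('w \<Rightarrow> 'v) \<Rightarrow>
     ('v \<Rightarrow> real ^ 'k) \<Rightarrow> ('x \<Rightarrow> real ^ 'k) \<Rightarrow> bool" where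
  "ASF_identified_known_q M SX X V q p0 \<longleftrightarrow>
     \<not> (\<exists>pb. pb \<in> borel_measurable SX \<and>
           (AE \<omega> in M. pb (X \<omega>) \<bullet> q (V \<omega>) = p0 (X \<omega>) \<bullet> q (V \<omega>)) \<and>
           measure M {\<omega> \<in> space M. pb (X \<omega>) \<bullet> (\<integral>\<omega>'. q (V \<omega>') \<partial>M)
                                  \<noteq> p0 (X \<omega>) \<bullet> (\<integral>\<omega>'. q (V \<omega>') \<partial>M)} > 0)"

end

theory Submission
  imports Defs
begin

text \<open>
  If two coefficient vectors are observationally equivalent, their difference
  \<open>d\<close>, a function of the conditioning variable \<open>Z\<close>, satisfies \<open>W' d(Z) = 0\<close> almost
  surely. Multiplying by \<open>W\<close> and conditioning on \<open>Z\<close> gives \<open>E[W W' | Z] d(Z) = 0\<close>, so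
  \<open>d(Z) = 0\<close> by nonsingularity: the coefficients themselves are identified, and hence
  so is the ASF.
\<close>

lemma subalgebra_sigma_gen:
  assumes "Z \<in> measurable M S"
  shows "subalgebra M (sigma_gen M S Z)"
  using assms unfolding subalgebra_def sigma_gen_def
  by (auto simp: sets_vimage_algebra2 measurable_def)

lemma measurable_sigma_gen:
  assumes "Z \<in> measurable M S"
  shows "Z \<in> measurable (sigma_gen M S Z) S"
  using assms unfolding sigma_gen_def
  by (intro measurable_vimage_algebra1) (auto simp: measurable_def)

text \<open>Kept abstract in \<open>W\<close> and \<open>Z\<close> so that one argument serves both
  cases: \<open>W = p(X)\<close>, \<open>Z = V\<close> in the first, \<open>W = q(V)\<close>,
  \<open>Z = X\<close> in the second. Integrability of the products \<open>W $ i * W $ j\<close>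
  makes \<open>cond_second_moment\<close> a genuine conditional expectation, as
  \<open>real_cond_exp\<close> is a total function.\<close>

lemma (in prob_space) coefficient_eq_zero:
  fixes W :: "'a \<Rightarrow> real ^ 'n" and d :: "'b \<Rightarrow> real ^ 'n"
  assumes Z: "Z \<in> measurable M S"
    and d: "d \<in> borel_measurable S"
    and W: "\<And>i j. integrable M (\<lambda>\<omega>. W \<omega> $ i * W \<omega> $ j)"
    and zero: "AE \<omega> in M. W \<omega> \<bullet> d (Z \<omega>) = 0"
    and inv: "AE \<omega> in M. invertible (cond_second_moment M S Z W \<omega>)"
  shows "AE \<omega> in M. d (Z \<omega>) = 0"
proof -
  let ?F = "sigma_gen M S Z"
  \<comment> \<open>The rules for \<open>real_cond_exp\<close> ask for sigma-finiteness on the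
    sub-sigma-algebra, which is automatic for a finite measure.\<close>
  interpret finite_measure_subalgebra M ?F
    by unfold_locales (rule subalgebra_sigma_gen[OF Z])
  \<comment> \<open>Normalising \<open>d\<close> to a bounded function makes the products below integrable
    without any moment assumption on \<open>d (Z \<omega>)\<close>.\<close>
  define b where "b \<omega> = (1 / (1 + norm (d (Z \<omega>)))) *\<^sub>R d (Z \<omega>)" for \<omega>
  have [measurable]: "(\<lambda>\<omega>. d (Z \<omega>)) \<in> borel_measurable ?F"
    by (rule measurable_compose[OF measurable_sigma_gen[OF Z] d])
  have b_F[measurable]: "b \<in> borel_measurable ?F"
    unfolding b_def by measurable
  have b_comp_F: "(\<lambda>\<omega>. b \<omega> $ j) \<in> borel_measurable ?F" for j
    by (rule measurable_compose[OF b_F])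
      (intro borel_measurable_continuous_onI continuous_intros)
  have b_comp_M[measurable]: "(\<lambda>\<omega>. b \<omega> $ j) \<in> borel_measurable M" for j
    by (rule measurable_from_subalg[OF subalg b_comp_F])
  have b_bound: "\<bar>b \<omega> $ j\<bar> \<le> 1" for \<omega> j
  proof -
    have "norm (b \<omega>) \<le> 1"
      by (simp add: b_def divide_simps add_pos_nonneg)
    then show ?thesis
      using component_le_norm_cart[of "b \<omega>" j] by linarith
  qed
  \<comment> \<open>Dominated by \<open>W $ i * W $ j\<close>, because each component of
    \<open>b\<close> has absolute value at most 1.\<close>
  have int: "integrable M (\<lambda>\<omega>. b \<omega> $ j * (W \<omega> $ i * W \<omega> $ j))" for i j
    by (rule Bochner_Integration.integrable_bound[OF W[of i j]])
      (use borel_measurable_integrable[OF W[of i j]] b_bound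
        in \<open>auto simp: abs_mult intro!: mult_left_le_one_le\<close>)
  \<comment> \<open>Row \<open>i\<close> of E[W W' | Z] b is E[W_i (W' b) | Z]: the factors
    \<open>b $ j\<close> are \<open>?F\<close>-measurable, so they move inside the conditional
    expectation, and the finite sum over \<open>j\<close> is then collected.\<close>
  have row: "AE \<omega> in M. (cond_second_moment M S Z W \<omega> *v b \<omega>) $ i = 0" for i
  proof -
    have "AE \<omega> in M. \<forall>j. real_cond_exp M ?F (\<lambda>\<omega>. b \<omega> $ j * (W \<omega> $ i * W \<omega> $ j)) \<omega>
        = b \<omega> $ j * real_cond_exp M ?F (\<lambda>\<omega>. W \<omega> $ i * W \<omega> $ j) \<omega>"
      by (rule AE_all_countable[THEN iffD2])
        (use real_cond_exp_mult[OF b_comp_F _ int] borel_measurable_integrable[OF W] in blast)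
    moreover have "AE \<omega> in M. real_cond_exp M ?F (\<lambda>\<omega>. \<Sum>j\<in>UNIV. b \<omega> $ j * (W \<omega> $ i * W \<omega> $ j)) \<omega>
        = (\<Sum>j\<in>UNIV. real_cond_exp M ?F (\<lambda>\<omega>. b \<omega> $ j * (W \<omega> $ i * W \<omega> $ j)) \<omega>)"
      by (rule real_cond_exp_sum) (rule int)
    moreover have "AE \<omega> in M. real_cond_exp M ?F (\<lambda>\<omega>. \<Sum>j\<in>UNIV. b \<omega> $ j * (W \<omega> $ i * W \<omega> $ j)) \<omega>
        = real_cond_exp M ?F (\<lambda>_. 0) \<omega>"
    proof (rule real_cond_exp_cong)
      \<comment> \<open>The collected integrand contains the factor \<open>W \<bullet> b\<close>, a
        scalar multiple of \<open>W \<bullet> d(Z)\<close>, which vanishes almost surely by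
        \<open>zero\<close>.\<close>
      have *: "(\<Sum>j\<in>UNIV. b \<omega> $ j * (W \<omega> $ i * W \<omega> $ j)) = W \<omega> $ i * (W \<omega> \<bullet> b \<omega>)" for \<omega>
        by (simp add: inner_vec_def sum_distrib_left mult_ac)
      show "AE \<omega> in M. (\<Sum>j\<in>UNIV. b \<omega> $ j * (W \<omega> $ i * W \<omega> $ j)) = 0"
        using zero unfolding * by eventually_elim (simp add: b_def)
    qed (use int borel_measurable_integrable in auto)
    moreover have "AE \<omega> in M. real_cond_exp M ?F (\<lambda>_. 0) \<omega> = 0"
      by (rule real_cond_exp_F_meas) auto
    ultimately show ?thesis
      by eventually_elim
        (simp add: matrix_vector_mult_def cond_second_moment_def cond_exp_given_def mult.commute)
  qed
  have "AE \<omega> in M. \<forall>i. (cond_second_moment M S Z W \<omega> *v b \<omega>) $ i = 0"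
    by (rule AE_all_countable[THEN iffD2]) (use row in blast)
  with inv show ?thesis
  proof eventually_elim
    case (elim \<omega>)
    from elim(1) obtain B where "B ** cond_second_moment M S Z W \<omega> = mat 1"
      unfolding invertible_def by blast
    moreover have "cond_second_moment M S Z W \<omega> *v b \<omega> = 0"
      using elim(2) by (simp add: vec_eq_iff)
    \<comment> \<open>A matrix with a left inverse has trivial kernel.\<close>
    ultimately have "b \<omega> = 0"
      by (metis matrix_left_invertible_ker)
    \<comment> \<open>The normalising factor never vanishes, so \<open>b = 0\<close> forces
      \<open>d = 0\<close>.\<close>
    moreover have "1 + norm (d (Z \<omega>)) \<noteq> 0"
      using norm_ge_zero[of "d (Z \<omega>)"] by linarith
    ultimately show "d (Z \<omega>) = 0"
      by (simp add: b_def)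
  qed
qed

text \<open>The preceding lemma applied to the difference \<open>c - c'\<close>, in the form that
  observational equivalence supplies.\<close>

lemma (in prob_space) coefficient_unique:
  fixes W :: "'a \<Rightarrow> real ^ 'n" and c c' :: "'b \<Rightarrow> real ^ 'n"
  assumes "Z \<in> measurable M S" "c \<in> borel_measurable S" "c' \<in> borel_measurable S"
    and "\<And>i j. integrable M (\<lambda>\<omega>. W \<omega> $ i * W \<omega> $ j)"
    and "AE \<omega> in M. W \<omega> \<bullet> c (Z \<omega>) = W \<omega> \<bullet> c' (Z \<omega>)"
    and "AE \<omega> in M. invertible (cond_second_moment M S Z W \<omega>)"
  shows "AE \<omega> in M. c (Z \<omega>) = c' (Z \<omega>)"
  using coefficient_eq_zero[of Z S "\<lambda>z. c z - c' z" W] assms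
  by (simp add: inner_diff_right)

theorem theorem3:
  fixes M :: "'w measure"
    and SX :: "'x measure" and X :: "'w \<Rightarrow> 'x"
    and SE :: "'e measure" and eps :: "'w \<Rightarrow> 'e"
    and SV :: "'v measure" and V :: "'w \<Rightarrow> 'v"
    and g :: "'x \<Rightarrow> 'e \<Rightarrow> real" and Y :: "'w \<Rightarrow> real"
    and p :: "'x \<Rightarrow> real ^ 'j" and q0 :: "'v \<Rightarrow> real ^ 'j"
    and p0 :: "'x \<Rightarrow> real ^ 'k" and q :: "'v \<Rightarrow> real ^ 'k"
  assumes "prob_space M"
    and "X \<in> measurable M SX"
    and "eps \<in> measurable M SE"
    and "(\<lambda>(x, e). g x e) \<in> borel_measurable (SX \<Otimes>\<^sub>M SE)"
    and "\<And>\<omega>. \<omega> \<in> space M \<Longrightarrow> Y \<omega> = g (X \<omega>) (eps \<omega>)"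
    and "control_variable M SX X SE eps SV V"
    and "integrable M Y"
    and "AE \<omega> in M. integrable (distr M SE eps) (g (X \<omega>))"
  shows
    "(p \<in> borel_measurable SX \<and> q0 \<in> borel_measurable SV \<and>
      integrable M (\<lambda>\<omega>. q0 (V \<omega>)) \<and>
      (\<forall>i j. integrable M (\<lambda>\<omega>. p (X \<omega>) $ i * p (X \<omega>) $ j)) \<and>
      (AE \<omega> in M. cond_exp_given M (SX \<Otimes>\<^sub>M SV) (\<lambda>\<omega>'. (X \<omega>', V \<omega>')) Y \<omega>
                  = p (X \<omega>) \<bullet> q0 (V \<omega>)) \<and>
      (AE \<omega> in M. ASF M SE eps g (X \<omega>) = p (X \<omega>) \<bullet> (\<integral>\<omega>'. q0 (V \<omega>') \<partial>M)) \<and>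
      integrable M (\<lambda>\<omega>. (p (X \<omega>) \<bullet> q0 (V \<omega>))\<^sup>2) \<and>
      (AE \<omega> in M. invertible (cond_second_moment M SV V (\<lambda>\<omega>'. p (X \<omega>')) \<omega>))
      \<longrightarrow> ASF_identified_known_p M X SV V p q0)
     \<and>
     (p0 \<in> borel_measurable SX \<and> q \<in> borel_measurable SV \<and>
      integrable M (\<lambda>\<omega>. q (V \<omega>)) \<and>
      (\<forall>i j. integrable M (\<lambda>\<omega>. q (V \<omega>) $ i * q (V \<omega>) $ j)) \<and>
      (AE \<omega> in M. cond_exp_given M (SX \<Otimes>\<^sub>M SV) (\<lambda>\<omega>'. (X \<omega>', V \<omega>')) Y \<omega>
                  = p0 (X \<omega>) \<bullet> q (V \<omega>)) \<and>
      (AE \<omega> in M. ASF M SE eps g (X \<omega>) = p0 (X \<omega>) \<bullet> (\<integral>\<omega>'. q (V \<omega>') \<partial>M)) \<and>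
      integrable M (\<lambda>\<omega>. (p0 (X \<omega>) \<bullet> q (V \<omega>))\<^sup>2) \<and>
      (AE \<omega> in M. invertible (cond_second_moment M SX X (\<lambda>\<omega>'. q (V \<omega>')) \<omega>))
      \<longrightarrow> ASF_identified_known_q M SX X V q p0)"
proof -
  interpret prob_space M by fact
  have V: "V \<in> measurable M SV"
    using assms(6) by (simp add: control_variable_def)
  show ?thesis
  proof (intro conjI impI)
    assume H: "p \<in> borel_measurable SX \<and> q0 \<in> borel_measurable SV \<and>
      integrable M (\<lambda>\<omega>. q0 (V \<omega>)) \<and>
      (\<forall>i j. integrable M (\<lambda>\<omega>. p (X \<omega>) $ i * p (X \<omega>) $ j)) \<and>
      (AE \<omega> in M. cond_exp_given M (SX \<Otimes>\<^sub>M SV) (\<lambda>\<omega>'. (X \<omega>', V \<omega>')) Y \<omega>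
                  = p (X \<omega>) \<bullet> q0 (V \<omega>)) \<and>
      (AE \<omega> in M. ASF M SE eps g (X \<omega>) = p (X \<omega>) \<bullet> (\<integral>\<omega>'. q0 (V \<omega>') \<partial>M)) \<and>
      integrable M (\<lambda>\<omega>. (p (X \<omega>) \<bullet> q0 (V \<omega>))\<^sup>2) \<and>
      (AE \<omega> in M. invertible (cond_second_moment M SV V (\<lambda>\<omega>'. p (X \<omega>')) \<omega>))"
    show "ASF_identified_known_p M X SV V p q0"
      unfolding ASF_identified_known_p_def
    proof (intro notI, elim exE conjE)
      fix qb
      assume qb: "qb \<in> borel_measurable SV" "integrable M (\<lambda>\<omega>. qb (V \<omega>))"
        and eq: "AE \<omega> in M. p (X \<omega>) \<bullet> qb (V \<omega>) = p (X \<omega>) \<bullet> q0 (V \<omega>)"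
        and pos: "0 < measure M {\<omega> \<in> space M. p (X \<omega>) \<bullet> (\<integral>\<omega>'. qb (V \<omega>') \<partial>M)
                                  \<noteq> p (X \<omega>) \<bullet> (\<integral>\<omega>'. q0 (V \<omega>') \<partial>M)}"
      \<comment> \<open>Here the regressor is \<open>p(X)\<close> and the conditioning variable is
        \<open>V\<close>.\<close>
      have "AE \<omega> in M. qb (V \<omega>) = q0 (V \<omega>)"
        using coefficient_unique[OF V qb(1) _ _ eq] H by blast
      \<comment> \<open>Almost sure equality passes to the expectations, so the set in
        \<open>pos\<close> is empty.\<close>
      then have "(\<integral>\<omega>. qb (V \<omega>) \<partial>M) = (\<integral>\<omega>. q0 (V \<omega>) \<partial>M)"
        using qb(2) H by (intro integral_cong_AE) auto
      with pos show False by simp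
    qed
  next
    assume H: "p0 \<in> borel_measurable SX \<and> q \<in> borel_measurable SV \<and>
      integrable M (\<lambda>\<omega>. q (V \<omega>)) \<and>
      (\<forall>i j. integrable M (\<lambda>\<omega>. q (V \<omega>) $ i * q (V \<omega>) $ j)) \<and>
      (AE \<omega> in M. cond_exp_given M (SX \<Otimes>\<^sub>M SV) (\<lambda>\<omega>'. (X \<omega>', V \<omega>')) Y \<omega>
                  = p0 (X \<omega>) \<bullet> q (V \<omega>)) \<and>
      (AE \<omega> in M. ASF M SE eps g (X \<omega>) = p0 (X \<omega>) \<bullet> (\<integral>\<omega>'. q (V \<omega>') \<partial>M)) \<and>
      integrable M (\<lambda>\<omega>. (p0 (X \<omega>) \<bullet> q (V \<omega>))\<^sup>2) \<and>
      (AE \<omega> in M. invertible (cond_second_moment M SX X (\<lambda>\<omega>'. q (V \<omega>')) \<omega>))"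
    show "ASF_identified_known_q M SX X V q p0"
      unfolding ASF_identified_known_q_def
    proof (intro notI, elim exE conjE)
      fix pb
      assume pb: "pb \<in> borel_measurable SX"
        and eq: "AE \<omega> in M. pb (X \<omega>) \<bullet> q (V \<omega>) = p0 (X \<omega>) \<bullet> q (V \<omega>)"
        and pos: "0 < measure M {\<omega> \<in> space M. pb (X \<omega>) \<bullet> (\<integral>\<omega>'. q (V \<omega>') \<partial>M)
                                  \<noteq> p0 (X \<omega>) \<bullet> (\<integral>\<omega>'. q (V \<omega>') \<partial>M)}"
      \<comment> \<open>These make the disagreement set of the two ASFs measurable, as
        \<open>AE_iff_null_sets\<close> requires below.\<close>
      have [measurable]: "(\<lambda>\<omega>. pb (X \<omega>)) \<in> borel_measurable M"
        "(\<lambda>\<omega>. p0 (X \<omega>)) \<in> borel_measurable M"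
        using pb H measurable_compose[OF assms(2)] by blast+
      \<comment> \<open>The roles are exchanged: \<open>q(V)\<close> is now the regressor and the
        unknown coefficient is a function of \<open>X\<close>.\<close>
      have eq': "AE \<omega> in M. q (V \<omega>) \<bullet> pb (X \<omega>) = q (V \<omega>) \<bullet> p0 (X \<omega>)"
        using eq by (simp add: inner_commute)
      have "AE \<omega> in M. pb (X \<omega>) = p0 (X \<omega>)"
        using coefficient_unique[OF assms(2) pb _ _ eq'] H by blast
      \<comment> \<open>Both sides share the vector E[q(V)], so they can differ only where
        \<open>pb(X)\<close> and \<open>p0(X)\<close> differ. Unlike in the first case, the
        exceptional set need not be empty, only null.\<close>
      then have "AE \<omega> in M. \<not> (pb (X \<omega>) \<bullet> (\<integral>\<omega>'. q (V \<omega>') \<partial>M)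
                                  \<noteq> p0 (X \<omega>) \<bullet> (\<integral>\<omega>'. q (V \<omega>') \<partial>M))"
        by eventually_elim simp
      then have "measure M {\<omega> \<in> space M. pb (X \<omega>) \<bullet> (\<integral>\<omega>'. q (V \<omega>') \<partial>M)
                                  \<noteq> p0 (X \<omega>) \<bullet> (\<integral>\<omega>'. q (V \<omega>') \<partial>M)} = 0"
        by (intro measure_eq_0_null_sets AE_iff_null_sets[THEN iffD2]) auto
      with pos show False by simp
    qed
  qed
qed

end
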